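(* Let $q\ge 2$ be even, let $\mathbf f\in A_q^+\setminus U_q$ have last symbol $0$, and let $\ell$ be the length of the maximal suffix of $\mathbf f$ consisting only of $0$s. Then for every $n\ge1$, the set $A_q^n(\mathbf f)$ listed in $\prec$ order is an at most $(\ell+2)$-close $3$-Gray code: any two consecutive words in the list differ in at most $3$ positions, and the leftmost and rightmost positions where they differ are separated by at most $\ell+1$ symbols.
   Context: $A_q=\{0,1,\dots,q-1\}$; $A_q^n$ is the set of length-$n$ words over $A_q$, $A_q^+$ the nonempty finite words. For a set $X$ of words, $X(\mathbf f)$ is the set of words of $X$ not containing $\mathbf f$ as a factor (contiguous subword). For distinct words $\mathbf s,\mathbf t$ of equal length, with $k$ the leftmost differing position and $u=\sum_{i<k}s_i$, $\mathbf s\prec\mathbf t$ iff ($u$ even and $s_k<t_k$) or ($u$ odd and $s_k>t_k$). $\mathbf a^i$ is $i$-fold concatenation and $\mathbf a^{-\infty}=\cdots\mathbf a\mathbf a$ the left-infinite word; a suffix of it is a finite (possibly empty) word with which it ends. $U_q=\bigcup_{m\ge0}\{\mathbf b0:\mathbf b\text{ a suffix of }(1(q-1)0^m)^{-\infty}\}$. *)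

theory Defs
  imports Main "HOL-Library.Sublist"
begin

definition words :: "nat \<Rightarrow> nat \<Rightarrow> nat list set" where
  "words q n = {w. length w = n \<and> set w \<subseteq> {..<q}}"

definition avoiding :: "nat list set \<Rightarrow> nat list \<Rightarrow> nat list set" where
  "avoiding X f = {w \<in> X. \<not> sublist f w}"

definition prec :: "nat list \<Rightarrow> nat list \<Rightarrow> bool" where
  "prec s t \<longleftrightarrow> length s = length t \<and>
     (\<exists>k < length s. take k s = take k t \<and>
        (even (sum_list (take k s)) \<and> s ! k < t ! k \<or>
         odd (sum_list (take k s)) \<and> s ! k > t ! k))"

text \<open>
  A left-infinite word is a function on \<^typ>\<open>nat\<close> that numbers the symbols from
  right to left, so that the last symbol has index 0.
\<close>

definition left_inf_power :: "'a list \<Rightarrow> nat \<Rightarrow> 'a" where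
  "left_inf_power a i = rev a ! (i mod length a)"

definition left_inf_suffix :: "'a list \<Rightarrow> (nat \<Rightarrow> 'a) \<Rightarrow> bool" where
  "left_inf_suffix b u \<longleftrightarrow> (\<forall>i < length b. rev b ! i = u i)"

definition U :: "nat \<Rightarrow> nat list set" where
  "U q = (\<Union>m. {b @ [0] | b. left_inf_suffix b (left_inf_power ([1, q - 1] @ replicate m 0))})"

definition trailing_zeros :: "nat list \<Rightarrow> nat" where
  "trailing_zeros f = length (takeWhile (\<lambda>x. x = 0) (rev f))"

text \<open>
  The listing of a set in \<^const>\<open>prec\<close> order. It is only meaningful for finite sets of
  words of one length; there it exists and is unique by \<open>prec_listing_ex1\<close> below.
\<close>

definition prec_listing :: "nat list set \<Rightarrow> nat list list" where
  "prec_listing X = (THE xs. set xs = X \<and> sorted_wrt prec xs)"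

definition diff_positions :: "'a list \<Rightarrow> 'a list \<Rightarrow> nat set" where
  "diff_positions s t = {i. i < length s \<and> s ! i \<noteq> t ! i}"

text \<open>
  In a \<open>d\<close>-close code the extreme positions at which consecutive words differ are separated
  by at most \<open>d - 1\<close> symbols. Closeness is an upper bound here, not an exact value.
\<close>

definition close_gray_code :: "nat \<Rightarrow> nat \<Rightarrow> 'a list list \<Rightarrow> bool" where
  "close_gray_code d k xs \<longleftrightarrow>
     (\<forall>i. Suc i < length xs \<longrightarrow>
        (let D = diff_positions (xs ! i) (xs ! Suc i)
         in card D \<le> k \<and> card {Min D <..< Max D} < d))"

lemma prec_irrefl: "\<not> prec s s"
  by (auto simp: prec_def)

lemma prec_trans:
  assumes "prec r s" "prec s t"
  shows "prec r t"
proof -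
  from assms(1) obtain j where j: "length r = length s" "j < length r" "take j r = take j s"
    "even (sum_list (take j r)) \<and> r ! j < s ! j \<or> odd (sum_list (take j r)) \<and> r ! j > s ! j"
    by (auto simp: prec_def)
  from assms(2) obtain k where k: "length s = length t" "k < length s" "take k s = take k t"
    "even (sum_list (take k s)) \<and> s ! k < t ! k \<or> odd (sum_list (take k s)) \<and> s ! k > t ! k"
    by (auto simp: prec_def)
  have take_le: "take i xs = take i ys" if "take m xs = take m ys" "i \<le> m"
    for i m and xs ys :: "nat list"
    using that by (metis min.absorb1 take_take)
  have nth_eq: "xs ! i = ys ! i" if "take m xs = take m ys" "i < m"
    for i m and xs ys :: "nat list"
    using that by (metis nth_take)
  consider "j < k" | "j = k" | "k < j" by linarith
  then show ?thesis
  proof cases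
    case 1
    then have "take j r = take j t" "s ! j = t ! j"
      using j(3) take_le[OF k(3), of j] nth_eq[OF k(3) 1] by auto
    with j k(1) show ?thesis unfolding prec_def by auto
  next
    case 2
    with j k show ?thesis unfolding prec_def by auto
  next
    case 3
    then have "take k r = take k s" "r ! k = s ! k"
      using take_le[OF j(3), of k] nth_eq[OF j(3) 3] by auto
    with j(1) k show ?thesis unfolding prec_def by auto
  qed
qed

lemma prec_total:
  assumes "length s = length t" "s \<noteq> t"
  shows "prec s t \<or> prec t s"
proof -
  from assms have "\<exists>i. i < length s \<and> s ! i \<noteq> t ! i"
    by (auto simp: list_eq_iff_nth_eq)
  then obtain k where k: "k < length s" "s ! k \<noteq> t ! k"
    and min: "\<And>i. i < k \<Longrightarrow> \<not> (i < length s \<and> s ! i \<noteq> t ! i)"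
    using exists_least_iff[of "\<lambda>i. i < length s \<and> s ! i \<noteq> t ! i"] by blast
  have "take k s = take k t"
    using k min assms(1) by (intro nth_equalityI) auto
  with k assms(1) show ?thesis
    unfolding prec_def by (metis linorder_neqE_nat)
qed

lemma prec_listing_ex1:
  assumes "finite X" "\<And>w. w \<in> X \<Longrightarrow> length w = n"
  shows "\<exists>!xs. set xs = X \<and> sorted_wrt prec xs"
proof (rule ex_ex1I)
  show "\<exists>xs. set xs = X \<and> sorted_wrt prec xs"
    using assms
  proof (induction X rule: finite_induct)
    case empty
    show ?case by (rule exI[of _ "[]"]) simp
  next
    case (insert a X)
    then obtain xs where xs: "set xs = X" "sorted_wrt prec xs" by auto
    let ?ys = "filter (\<lambda>x. prec x a) xs @ a # filter (prec a) xs"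
    have "prec x a \<or> prec a x" if "x \<in> X" for x
      using that insert.hyps(2) insert.prems by (intro prec_total) auto
    then have "set ?ys = insert a X"
      using xs(1) by auto
    moreover have "sorted_wrt prec ?ys"
      using xs(2) by (auto simp: sorted_wrt_append sorted_wrt_filter intro: prec_trans)
    ultimately show ?case by blast
  qed
next
  fix xs ys
  assume "set xs = X \<and> sorted_wrt prec xs" "set ys = X \<and> sorted_wrt prec ys"
  then have "set xs = set ys" "sorted_wrt prec xs" "sorted_wrt prec ys" by auto
  then show "xs = ys"
  proof (induction xs arbitrary: ys)
    case Nil
    then show ?case by simp
  next
    case (Cons x xs)
    then obtain y zs where ys: "ys = y # zs" by (cases ys) auto
    have "x = y"
    proof (rule ccontr)
      assume "x \<noteq> y"
      with Cons.prems ys have "prec x y" "prec y x" by auto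
      then show False using prec_trans prec_irrefl by blast
    qed
    moreover from this have "set xs = set zs"
    proof -
      have "x \<notin> set xs" "y \<notin> set zs"
        using Cons.prems ys prec_irrefl by auto
      then show ?thesis
        using Cons.prems(1) ys \<open>x = y\<close> by (simp add: insert_ident)
    qed
    ultimately show ?case using Cons ys by auto
  qed
qed

lemma finite_avoiding_words: "finite (avoiding (words q n) f)"
proof (rule finite_subset)
  show "avoiding (words q n) f \<subseteq> {w. set w \<subseteq> {..<q} \<and> length w = n}"
    by (auto simp: avoiding_def words_def)
qed (simp add: finite_lists_length_eq)

lemma prec_listing_avoiding:
  "set (prec_listing (avoiding (words q n) f)) = avoiding (words q n) f"
  "sorted_wrt prec (prec_listing (avoiding (words q n) f))"
proof -
  have "\<exists>!xs. set xs = avoiding (words q n) f \<and> sorted_wrt prec xs"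
    by (rule prec_listing_ex1[OF finite_avoiding_words, of _ _ _ n])
      (auto simp: avoiding_def words_def)
  from theI'[OF this]
  show "set (prec_listing (avoiding (words q n) f)) = avoiding (words q n) f"
    "sorted_wrt prec (prec_listing (avoiding (words q n) f))"
    unfolding prec_listing_def by auto
qed

end

(*
  Write f = x 0^l with x nonempty and not ending in 0. As f ends in 0, a word avoiding f can
  always be continued by a nonzero symbol, so consecutive words s, t of the list have the form
  p a ... and p b ... with |a - b| = 1, where s is the last word of the list with prefix p a and
  t is the first one with prefix p b. The parities of p a and p b differ. If p a is odd, then a
  and b are nonzero; if p a is even, then both s and t continue with q - 1. So s and t are both
  greedy continuations of words of equal length that end in a nonzero symbol and differ at one
  position only. The greedy continuation is 0 0 0 ..., except that 0^l must be replaced by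
  0^(l-1) 1 (q-1) 0 0 ... where it would complete f, and this suffices because f is not in U q.
*)

theory Submission
  imports Defs
begin

section \<open>Comparing words by their prefixes\<close>

lemma first_difference:
  fixes s t :: "nat list"
  assumes "length s = length t" "s \<noteq> t"
  obtains k where "k < length s" "take k s = take k t" "s ! k \<noteq> t ! k"
  using prec_total[OF assms] unfolding prec_def by (metis nat_neq_iff)

text \<open>The order is decided at the first difference, which lies before \<open>k\<close> because
  the prefixes of length \<open>k\<close> already differ. What follows these prefixes can be
  exchanged freely.\<close>

lemma prec_trans_prefix:
  assumes "prec s t" "take k s \<noteq> take k t" "take k s' = take k s" "take k t' = take k t"
    "length s' = length s" "length t' = length t"
  shows "prec s' t'"
proof -
  from assms(1) obtain i where i: "length s = length t" "i < length s" "take i s = take i t"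
    "even (sum_list (take i s)) \<and> s ! i < t ! i \<or> odd (sum_list (take i s)) \<and> s ! i > t ! i"
    by (auto simp: prec_def)
  have "i < k"
  proof (rule ccontr)
    assume "\<not> i < k"
    then have "take k s = take k t"
      using i(3) by (metis min.absorb1 not_less take_take)
    with assms(2) show False ..
  qed
  then have "take i s' = take i s" "take i t' = take i t" "s' ! i = s ! i" "t' ! i = t ! i"
    using assms(3,4) by (metis min.absorb1 less_imp_le take_take, metis min.absorb1 less_imp_le take_take,
        metis nth_take, metis nth_take)
  with i assms(5,6) show ?thesis
    unfolding prec_def by auto
qed

section \<open>The forbidden factor and the greedy continuation\<close>

locale zero_ended_factor =
  fixes q l n :: nat and x :: "nat list"
  assumes q: "q \<ge> 2" "even q"
    and l: "l \<ge> 1"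
    and x: "x \<noteq> []" "last x \<noteq> 0"
    and not_U: "x @ replicate l 0 \<notin> U q"
begin

abbreviation f :: "nat list" where
  "f \<equiv> x @ replicate l 0"

abbreviation X :: "nat list set" where
  "X \<equiv> avoiding (words q n) f"

text \<open>
  As \<open>1 + (q - 1) = q\<close> is even, the parity of the prefix is restored after the detour, so the
  same continuation is the first one after an even word and the last one after an odd word.
\<close>

definition tail :: "nat list \<Rightarrow> nat list" where
  "tail \<alpha> = (if suffix x \<alpha> then replicate (l - 1) 0 @ [1, q - 1] @ replicate n 0
             else replicate n 0)"

text \<open>Both forms of \<open>tail\<close> have at least \<open>n\<close> symbols, so the cut
  always leaves exactly \<open>n\<close>.\<close>

definition completion :: "nat list \<Rightarrow> nat list" where
  "completion \<alpha> = take n (\<alpha> @ tail \<alpha>)"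

section \<open>Occurrences of \<open>f\<close> in extended words\<close>

text \<open>Neither \<open>x\<close> nor \<open>\<beta>\<close> ends in 0, so counting the trailing
  zeros on both sides forces \<open>i = l\<close>, and the zeros cancel.\<close>

lemma suffix_replicate_0:
  assumes "\<beta> \<noteq> []" "last \<beta> \<noteq> 0"
  shows "suffix f (\<beta> @ replicate i 0) \<longleftrightarrow> i = l \<and> suffix x \<beta>"
proof
  assume "suffix f (\<beta> @ replicate i 0)"
  then obtain zs where zs: "\<beta> @ replicate i 0 = (zs @ x) @ replicate l 0"
    by (auto simp: suffix_def)
  have len: "length (takeWhile (\<lambda>c. c = 0) (rev (\<gamma> @ replicate j 0))) = j"
    if "\<gamma> \<noteq> []" "last \<gamma> \<noteq> 0" for \<gamma> :: "nat list" and j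
  proof -
    have "takeWhile (\<lambda>c. c = 0) (rev \<gamma>) = []"
      using that by (cases \<gamma> rule: rev_cases) auto
    then show ?thesis
      by (simp add: takeWhile_append)
  qed
  have "i = l"
    using len[OF assms, of i] len[of "zs @ x" l] x zs by simp
  with zs show "i = l \<and> suffix x \<beta>"
    by (auto simp: suffix_def)
next
  assume "i = l \<and> suffix x \<beta>"
  then show "suffix f (\<beta> @ replicate i 0)"
    by (auto simp: suffix_def)
qed

lemma sublist_snocD:
  assumes "sublist g (\<beta> @ [c])"
  shows "sublist g \<beta> \<or> suffix g (\<beta> @ [c])"
proof -
  obtain ps ss where d: "\<beta> @ [c] = ps @ g @ ss"
    using assms by (auto simp: sublist_def)
  show ?thesis
  proof (cases ss rule: rev_cases)
    case Nil
    with d show ?thesis by (auto simp: suffix_def)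
  next
    case (snoc ss' c')
    with d have "\<beta> = ps @ g @ ss'" by simp
    then show ?thesis by (auto simp: sublist_def)
  qed
qed

text \<open>A new occurrence would have to end in the appended symbol, but \<open>f\<close> ends in
  0 because \<open>l\<close> is positive.\<close>

lemma avoids_snoc:
  assumes "\<not> sublist f \<beta>" "c \<noteq> 0"
  shows "\<not> sublist f (\<beta> @ [c])"
proof
  assume "sublist f (\<beta> @ [c])"
  from sublist_snocD[OF this] assms(1) have "suffix f (\<beta> @ [c])"
    by blast
  then obtain zs where zs: "\<beta> @ [c] = zs @ f"
    unfolding suffix_def by (rule exE)
  have "c = last (zs @ f)"
    by (simp only: zs[symmetric] last_snoc)
  also have "\<dots> = 0"
    using l by simp
  finally show False
    using assms(2) by contradiction
qed

text \<open>When zeros are appended one by one, a new occurrence of \<open>f\<close> can only appear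
  with the \<open>l\<close>-th zero, and only if \<open>\<beta>\<close> ends in
  \<open>x\<close>.\<close>

lemma avoids_replicate_0:
  assumes "\<not> sublist f \<beta>" "\<beta> \<noteq> []" "last \<beta> \<noteq> 0" "\<not> suffix x \<beta> \<or> i < l"
  shows "\<not> sublist f (\<beta> @ replicate i 0)"
  using assms(4)
proof (induction i)
  case 0
  with assms show ?case by simp
next
  case (Suc i)
  have eq: "\<beta> @ replicate (Suc i) 0 = (\<beta> @ replicate i 0) @ [0]"
    by (simp add: replicate_append_same)
  have "\<not> suffix f (\<beta> @ replicate (Suc i) 0)"
    using suffix_replicate_0[OF assms(2,3), of "Suc i"] Suc.prems by (auto simp del: replicate_Suc)
  moreover have "\<not> sublist f (\<beta> @ replicate i 0)"
    using Suc by linarith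
  ultimately show ?case
    using sublist_snocD[of f "\<beta> @ replicate i 0" 0] unfolding eq by blast
qed

text \<open>
  Two occurrences of \<open>x 0\<^sup>l\<^sup>-\<^sup>1\<close> at distance \<open>l + 1\<close> make this word periodic with
  period \<open>1 (q - 1) 0\<^sup>l\<^sup>-\<^sup>1\<close>, which is what membership of \<open>f\<close> in \<open>U q\<close> means.
\<close>

lemma stem_not_recurrent:
  assumes "suffix x \<alpha>"
  shows "\<not> suffix x (\<alpha> @ replicate (l - 1) 0 @ [1, q - 1])"
proof
  assume "suffix x (\<alpha> @ replicate (l - 1) 0 @ [1, q - 1])"
  \<comment> \<open>Here \<open>f\<close> is \<open>b\<close> followed by 0, and \<open>b\<close>
    ends both \<open>\<gamma>\<close> and \<open>\<gamma> @ \<pi>\<close>. Counted from the right,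
    the last \<open>length \<pi>\<close> symbols of \<open>b\<close> are read off
    \<open>\<pi>\<close>. Any earlier one equals the symbol \<open>length \<pi>\<close> places
    further right, via the occurrence at the end of \<open>\<gamma>\<close>.\<close>
  define \<gamma> where "\<gamma> = \<alpha> @ replicate (l - 1) 0"
  define \<pi> where "\<pi> = [1, q - 1] @ replicate (l - 1) 0"
  define b where "b = x @ replicate (l - 1) 0"
  have b1: "suffix b \<gamma>"
    using assms unfolding b_def \<gamma>_def by (auto simp: suffix_def)
  have b2: "suffix b (\<gamma> @ \<pi>)"
    using \<open>suffix x (\<alpha> @ replicate (l - 1) 0 @ [1, q - 1])\<close>
    unfolding b_def \<gamma>_def \<pi>_def by (auto simp: suffix_def)
  have nth: "rev b ! i = rev w ! i" if "suffix b w" "i < length b" for i w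
    using that by (auto simp: suffix_def nth_append)
  have "rev b ! i = left_inf_power \<pi> i" if "i < length b" for i
    using that
  proof (induction i rule: less_induct)
    case (less i)
    show ?case
    proof (cases "i < length \<pi>")
      case True
      have "rev b ! i = rev (\<gamma> @ \<pi>) ! i"
        using nth[OF b2 less.prems] .
      also have "\<dots> = rev \<pi> ! i"
        using True by (simp only: rev_append nth_append length_rev if_True)
      finally show ?thesis
        using True by (simp add: left_inf_power_def)
    next
      case False
      have pos: "length \<pi> > 0" by (simp add: \<pi>_def)
      have "rev b ! i = rev (\<gamma> @ \<pi>) ! i"
        using nth[OF b2 less.prems] .
      also have "\<dots> = rev \<gamma> ! (i - length \<pi>)"
        using False by (simp only: rev_append nth_append length_rev if_False)
      also have "\<dots> = rev b ! (i - length \<pi>)"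
        using nth[OF b1] less.prems by simp
      also have "\<dots> = left_inf_power \<pi> (i - length \<pi>)"
        using False less.prems pos by (intro less.IH) linarith+
      also have "\<dots> = left_inf_power \<pi> i"
        using False by (simp add: left_inf_power_def le_mod_geq)
      finally show ?thesis .
    qed
  qed
  then have "left_inf_suffix b (left_inf_power ([1, q - 1] @ replicate (l - 1) 0))"
    by (simp add: left_inf_suffix_def \<pi>_def)
  moreover have "f = b @ [0]"
    using l by (cases l) (auto simp: b_def replicate_append_same)
  ultimately have "f \<in> U q"
    unfolding U_def by blast
  with not_U show False ..
qed

text \<open>The detour stops one zero short of \<open>f\<close>, and its symbols 1 and
  \<open>q - 1\<close> are nonzero, so they complete nothing. After it the word does not end in
  \<open>x\<close>, so any number of zeros is safe.\<close>

lemma avoids_completion: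
  assumes "\<not> sublist f \<alpha>" "\<alpha> \<noteq> []" "last \<alpha> \<noteq> 0"
  shows "\<not> sublist f (\<alpha> @ tail \<alpha>)"
proof (cases "suffix x \<alpha>")
  case True
  define \<beta> where "\<beta> = \<alpha> @ replicate (l - 1) 0 @ [1, q - 1]"
  have \<beta>: "\<beta> = ((\<alpha> @ replicate (l - 1) 0) @ [1]) @ [q - 1]"
    by (simp add: \<beta>_def)
  have "\<not> sublist f (\<alpha> @ replicate (l - 1) 0)"
    using avoids_replicate_0[OF assms] l by simp
  then have "\<not> sublist f \<beta>"
    unfolding \<beta> using q by (intro avoids_snoc) auto
  moreover have "\<not> suffix x \<beta>"
    using stem_not_recurrent[OF True] by (simp add: \<beta>_def)
  ultimately have "\<not> sublist f (\<beta> @ replicate n 0)"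
    using q by (intro avoids_replicate_0) (auto simp: \<beta>)
  with True show ?thesis
    by (simp add: tail_def \<beta>_def)
next
  case False
  then show ?thesis
    using avoids_replicate_0[OF assms] by (simp add: tail_def)
qed

lemma length_completion [simp]: "length (completion \<alpha>) = n"
  by (simp add: completion_def tail_def)

lemma take_completion:
  assumes "length \<alpha> \<le> n" "k \<le> length \<alpha>"
  shows "take k (completion \<alpha>) = take k \<alpha>"
  using assms by (simp add: completion_def)

lemma completion_in_X:
  assumes "\<not> sublist f \<alpha>" "\<alpha> \<noteq> []" "last \<alpha> \<noteq> 0" "set \<alpha> \<subseteq> {..<q}"
  shows "completion \<alpha> \<in> X"
proof -
  have "\<not> sublist f (completion \<alpha>)"
    using avoids_completion[OF assms(1-3)] unfolding completion_def
    by (meson prefix_imp_sublist sublist_order.order_trans take_is_prefix)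
  moreover have "set (\<alpha> @ tail \<alpha>) \<subseteq> {..<q}"
    using assms(4) q by (auto simp: tail_def split: if_splits)
  then have "set (completion \<alpha>) \<subseteq> {..<q}"
    unfolding completion_def using set_take_subset by (meson subset_trans)
  ultimately show ?thesis
    by (simp add: avoiding_def words_def)
qed

lemma X_take:
  assumes "w \<in> X"
  shows "\<not> sublist f (take k w)" "set (take k w) \<subseteq> {..<q}" "length w = n"
  using assms unfolding avoiding_def words_def
  by (auto dest: in_set_takeD sublist_order.order_trans[OF _ sublist_take])

lemma X_nth_less:
  assumes "w \<in> X" "i < n"
  shows "w ! i < q"
proof -
  have "set w \<subseteq> {..<q}" "i < length w"
    using assms by (auto simp: avoiding_def words_def)
  then show ?thesis
    using nth_mem by blast
qed

section \<open>Extremality and differences of completions\<close>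

text \<open>At the first deviation of \<open>w\<close>, each symbol of the tail is the best
  possible: a 0 is least while the tail sum is even, the 1 is least where 0 would complete
  \<open>f\<close>, and after this 1 the order is reversed, so \<open>q - 1\<close> comes first. An
  odd \<open>\<alpha>\<close> reverses the whole comparison.\<close>

lemma completion_extremal:
  assumes "w \<in> X" "take (length \<alpha>) w = \<alpha>" "w \<noteq> completion \<alpha>"
  shows "if even (sum_list \<alpha>) then prec (completion \<alpha>) w else prec w (completion \<alpha>)"
proof -
  let ?z = "completion \<alpha>"
  have len: "length w = n" using X_take[OF assms(1)] by simp
  obtain i where i: "i < n" "take i ?z = take i w" "?z ! i \<noteq> w ! i"
    using first_difference[of ?z w] assms(3) len by auto
  have \<alpha>n: "length \<alpha> \<le> n"
    using arg_cong[OF assms(2), of length] len by simp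
  have "\<not> i < length \<alpha>"
  proof
    assume "i < length \<alpha>"
    then have "?z ! i = w ! i"
      using assms(2) \<alpha>n by (metis (no_types) take_completion nth_take order_refl take_all)
    with i(3) show False ..
  qed
  then obtain d where d: "i = length \<alpha> + d"
    by (metis le_add_diff_inverse not_less)
  have z_take: "take i ?z = \<alpha> @ take d (tail \<alpha>)"
    using i(1) d by (simp add: completion_def)
  have z_nth: "?z ! i = tail \<alpha> ! d"
    using i(1) d by (simp add: completion_def)
  have w_less: "w ! i < q"
    using X_nth_less assms(1) i(1) by blast
  \<comment> \<open>The comparison relative to \<open>\<alpha>\<close>, whose own parity enters only
    at the end through \<open>sum\<close>.\<close>
  have parity: "even (sum_list (take d (tail \<alpha>))) \<and> tail \<alpha> ! d < w ! i \<or>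
    odd (sum_list (take d (tail \<alpha>))) \<and> tail \<alpha> ! d > w ! i"
  proof (cases "suffix x \<alpha>")
    case False
    then have "tail \<alpha> = replicate n 0" by (simp add: tail_def)
    then show ?thesis
      using i d z_nth by (simp add: sum_list_replicate)
  next
    case True
    then have t: "tail \<alpha> = replicate (l - 1) 0 @ [1, q - 1] @ replicate n 0"
      by (simp add: tail_def)
    \<comment> \<open>The deviation is in the first block of zeros, at the 1, at the
      \<open>q - 1\<close>, or in the final zeros.\<close>
    consider "d < l - 1" | "d = l - 1" | "d = l" | e where "d = Suc l + e"
      using l by (metis One_nat_def Suc_pred le_add_diff_inverse less_eq_Suc_le less_antisym not_less
          linorder_neqE_nat)
    then show ?thesis
    proof cases
      case 1
      then show ?thesis
        using i z_nth by (simp add: t sum_list_replicate nth_append)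
    next
      case 2
      have "w ! i \<noteq> 0"
      proof
        assume "w ! i = 0"
        then have "take (Suc i) w = \<alpha> @ replicate (l - 1) 0 @ [0]"
          using i len z_take 2 by (simp add: take_Suc_conv_app_nth t)
        also have "\<dots> = \<alpha> @ replicate l 0"
          using l by (cases l) (auto simp: replicate_append_same)
        finally have "suffix f (take (Suc i) w)"
          using True by (auto simp: suffix_def)
        with X_take(1)[OF assms(1)] show False
          using suffix_imp_sublist by blast
      qed
      then show ?thesis
        using i z_nth 2 by (simp add: t sum_list_replicate nth_append)
    next
      case 3
      then have "d = Suc (l - 1)" using l by simp
      then show ?thesis
        using i z_nth w_less by (simp add: t sum_list_replicate nth_append take_Suc_conv_app_nth)
    next
      case 4
      then have d4: "d = (l - 1) + (2 + e)" using l by simp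
      have "e < n" using d4 d i(1) by simp
      then show ?thesis
        using i z_nth q by (simp add: t d4 sum_list_replicate nth_append)
    qed
  qed
  have sum: "sum_list (take i w) = sum_list \<alpha> + sum_list (take d (tail \<alpha>))"
    using z_take i(2) by simp
  have "prec ?z w" if "even (sum_list \<alpha>)"
    unfolding prec_def using that i(1,2) len parity sum z_nth by (intro conjI exI[of _ i]) auto
  moreover have "prec w ?z" if "odd (sum_list \<alpha>)"
    unfolding prec_def using that i(1,2) len parity sum z_nth by (intro conjI exI[of _ i]) auto
  ultimately show ?thesis by simp
qed

corollary completion_eqI:
  assumes "w \<in> X" "take (length \<alpha>) w = \<alpha>"
    and "if even (sum_list \<alpha>) then \<not> prec (completion \<alpha>) w else \<not> prec w (completion \<alpha>)"
  shows "w = completion \<alpha>"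
  using completion_extremal[OF assms(1,2)] assms(3) by (auto split: if_splits)

text \<open>A tail can be nonzero only at its indices \<open>l - 1\<close> and \<open>l\<close>,
  where the 1 and the \<open>q - 1\<close> of a detour stand. Equal lengths of
  \<open>\<alpha>\<close> and \<open>\<beta>\<close> align these places.\<close>

lemma diff_positions_completion:
  assumes "length \<alpha> = length \<beta>"
    and "\<And>i. i < length \<alpha> \<Longrightarrow> i \<noteq> k \<Longrightarrow> \<alpha> ! i = \<beta> ! i"
  shows "diff_positions (completion \<alpha>) (completion \<beta>) \<subseteq>
    {k, length \<alpha> + l - 1, length \<alpha> + l}"
proof
  fix i assume "i \<in> diff_positions (completion \<alpha>) (completion \<beta>)"
  then have i: "i < n" "completion \<alpha> ! i \<noteq> completion \<beta> ! i"
    by (auto simp: diff_positions_def)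
  then have i2: "(\<alpha> @ tail \<alpha>) ! i \<noteq> (\<beta> @ tail \<beta>) ! i"
    by (simp add: completion_def del: take_append)
  \<comment> \<open>The bound \<open>d < n\<close> keeps the index inside
    \<open>tail \<gamma>\<close> in both of its forms.\<close>
  have zero: "tail \<gamma> ! d = 0" if "d < n" "d \<noteq> l - 1" "d \<noteq> l" for \<gamma> d
    using that l by (auto simp: tail_def nth_append nth_Cons')
  show "i \<in> {k, length \<alpha> + l - 1, length \<alpha> + l}"
  proof (rule ccontr)
    assume *: "i \<notin> {k, length \<alpha> + l - 1, length \<alpha> + l}"
    show False
    proof (cases "i < length \<alpha>")
      case True
      with * i2 assms show False by (auto simp: nth_append)
    next
      case False
      then have "tail \<gamma> ! (i - length \<alpha>) = 0" for \<gamma>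
        using * i(1) l by (intro zero) auto
      with False i2 assms(1) show False by (simp add: nth_append)
    qed
  qed
qed

section \<open>Consecutive words\<close>

text \<open>The witness \<open>k\<close> is the first difference, and \<open>m\<close> is the common
  length of the prefixes whose completions are \<open>s\<close> and \<open>t\<close>, namely
  \<open>k + 1\<close> or \<open>k + 2\<close>.\<close>

lemma consecutive_close:
  assumes s: "s \<in> X" and t: "t \<in> X" and st: "prec s t"
    and consecutive: "\<And>w. w \<in> X \<Longrightarrow> prec s w \<Longrightarrow> \<not> prec w t"
  shows "\<exists>k m. m \<le> k + 2 \<and> k \<in> diff_positions s t \<and> k < m \<and>
    diff_positions s t \<subseteq> {k, m + l - 1, m + l}"
proof -
  have len: "length s = n" "length t = n"
    using X_take s t by auto
  obtain k where k: "k < n" "take k s = take k t"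
    "even (sum_list (take k s)) \<and> s ! k < t ! k \<or> odd (sum_list (take k s)) \<and> s ! k > t ! k"
    using st len by (auto simp: prec_def)
  define p a b where "p = take k s" and "a = s ! k" and "b = t ! k"
  have lp: "length p = k" using k len by (simp add: p_def)
  have sk: "take (Suc k) s = p @ [a]" and tk: "take (Suc k) t = p @ [b]"
    using k len by (auto simp: p_def a_def b_def take_Suc_conv_app_nth)
  have p: "\<not> sublist f p" "set p \<subseteq> {..<q}"
    using X_take[OF s] by (auto simp: p_def)
  have ab: "a < q" "b < q"
    using X_nth_less s t k(1) by (auto simp: a_def b_def)
  have ord: "even (sum_list p) \<and> a < b \<or> odd (sum_list p) \<and> a > b"
    using k(3) by (simp add: p_def a_def b_def)
  have kD: "k \<in> diff_positions s t"
    using ord len k(1) by (auto simp: diff_positions_def a_def b_def)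
  \<comment> \<open>A word after \<open>s\<close> with the same first \<open>k + 1\<close> symbols
    would still precede \<open>t\<close>, since \<open>s\<close> and \<open>t\<close> already differ
    there.\<close>
  have s_max: "\<not> prec s w" if "w \<in> X" "take (Suc k) w = p @ [a]" for w
  proof
    assume "prec s w"
    moreover have "prec w t"
      by (rule prec_trans_prefix[OF st, of "Suc k"])
        (use that sk tk ord X_take(3)[OF that(1)] len in auto)
    ultimately show False using consecutive that(1) by blast
  qed
  have t_min: "\<not> prec w t" if "w \<in> X" "take (Suc k) w = p @ [b]" for w
  proof
    assume "prec w t"
    moreover have "prec s w"
      by (rule prec_trans_prefix[OF st, of "Suc k"])
        (use that sk tk ord X_take(3)[OF that(1)] len in auto)
    ultimately show False using consecutive that(1) by blast
  qed
  have adjacent: "b = Suc a \<or> a = Suc b"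
  proof (rule ccontr)
    assume *: "\<not> (b = Suc a \<or> a = Suc b)"
    \<comment> \<open>Lying strictly between \<open>a\<close> and \<open>b\<close>, the symbol
      \<open>c\<close> is nonzero. So \<open>p @ [c]\<close> can be completed inside
      \<open>X\<close>, giving a word strictly between \<open>s\<close> and
      \<open>t\<close>.\<close>
    define c where "c = (if a < b then Suc a else Suc b)"
    define w where "w = completion (p @ [c])"
    have c: "c \<noteq> 0" "c < q" "a < c \<and> c < b \<or> b < c \<and> c < a"
      using * ab ord by (auto simp: c_def)
    have "w \<in> X"
      unfolding w_def using p c by (intro completion_in_X avoids_snoc) auto
    have wk: "take (Suc k) w = p @ [c]"
      unfolding w_def using take_completion[of "p @ [c]" "Suc k"] lp k(1) by simp
    have "length w = n" by (simp add: w_def)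
    then have w: "length w = n" "take k w = p" "w ! k = c"
      using wk lp k(1) by (auto simp: take_Suc_conv_app_nth)
    have takes: "take k s = p" "take k t = p"
      using k(2) by (simp_all add: p_def)
    have "even (sum_list p) \<and> a < c \<and> c < b \<or> odd (sum_list p) \<and> a > c \<and> c > b"
      using ord c(3) by auto
    then have "prec s w" "prec w t"
      unfolding prec_def by (auto intro!: exI[of _ k] simp: takes w len k(1) simp flip: a_def b_def)
    then show False using consecutive[OF \<open>w \<in> X\<close>] by simp
  qed
  have av: "\<not> sublist f (p @ [a])" "\<not> sublist f (p @ [b])"
    using X_take(1)[OF s, of "Suc k"] X_take(1)[OF t, of "Suc k"] sk tk by auto
  show ?thesis
  proof (cases "even (sum_list (p @ [a]))")
    case False
    \<comment> \<open>The smaller of \<open>a\<close> and \<open>b\<close> is odd: it is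
      \<open>a\<close> if \<open>p\<close> is even, and \<open>b\<close> if \<open>p\<close> is
      odd.\<close>
    then have pos: "a \<noteq> 0" "b \<noteq> 0" and even_b: "even (sum_list (p @ [b]))"
      using ord adjacent by (auto simp: odd_pos)
    have "completion (p @ [a]) \<in> X" "completion (p @ [b]) \<in> X"
      using pos av p ab by (auto intro!: completion_in_X)
    moreover have "take (Suc k) (completion (p @ [a])) = p @ [a]"
        "take (Suc k) (completion (p @ [b])) = p @ [b]"
      using lp k(1) by (subst take_completion; simp)+
    ultimately have "\<not> prec s (completion (p @ [a]))" "\<not> prec (completion (p @ [b])) t"
      using s_max t_min by auto
    then have "s = completion (p @ [a])" "t = completion (p @ [b])"
      using s t False even_b sk tk lp by (auto intro!: completion_eqI)
    then have "diff_positions s t \<subseteq> {k, Suc k + l - 1, Suc k + l}"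
      using diff_positions_completion[of "p @ [a]" "p @ [b]" k] lp by (simp add: nth_append)
    with kD show ?thesis
      by (intro exI[of _ k] exI[of _ "Suc k"]) auto
  next
    case True
    then have odd_b: "odd (sum_list (p @ [b]))"
      using adjacent by auto
    show ?thesis
    proof (cases "Suc k < n")
      case False
      \<comment> \<open>No symbol follows position \<open>k\<close>, so \<open>k\<close> is the only
        difference and any admissible \<open>m\<close> will do.\<close>
      have "s ! i = t ! i" if "i < k" for i
        using k(2) that by (metis nth_take)
      then have "diff_positions s t \<subseteq> {k}"
        using False len unfolding diff_positions_def by (auto simp: not_less) (meson le_less_trans less_SucE less_le_trans)
      with kD show ?thesis
        by (intro exI[of _ k] exI[of _ "Suc k"]) auto
    next
      case k': True
      \<comment> \<open>After the even \<open>p @ [a]\<close> the last word takes the largest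
        symbol, and after the odd \<open>p @ [b]\<close> the first word does. As
        \<open>q - 1\<close> is odd, \<open>\<alpha>\<close> is odd and \<open>\<beta>\<close> is
        even, so \<open>s\<close> and \<open>t\<close> are again the completions.\<close>
      define \<alpha> \<beta> where "\<alpha> = (p @ [a]) @ [q - 1]" and "\<beta> = (p @ [b]) @ [q - 1]"
      have lens: "length \<alpha> = Suc (Suc k)" "length \<beta> = Suc (Suc k)"
        by (auto simp: \<alpha>_def \<beta>_def lp)
      have "completion \<alpha> \<in> X" "completion \<beta> \<in> X"
        unfolding \<alpha>_def \<beta>_def using av p ab q
        by (simp_all add: completion_in_X avoids_snoc del: append_assoc)
      moreover have "take (Suc k) (completion \<alpha>) = p @ [a]"
        "take (Suc k) (completion \<beta>) = p @ [b]"
        using k' lens by (subst take_completion; simp add: \<alpha>_def \<beta>_def lp)+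
      ultimately have sz: "\<not> prec s (completion \<alpha>)" and tz: "\<not> prec (completion \<beta>) t"
        using s_max t_min by auto
      \<comment> \<open>One claim serves \<open>s\<close> and \<open>t\<close>: a smaller symbol at
        position \<open>Suc k\<close> would put \<open>w\<close> on the wrong side of the
        completion.\<close>
      have *: "take (Suc (Suc k)) w = u @ [q - 1]"
        if "w \<in> X" "take (Suc k) w = u"
          "if even (sum_list u) then \<not> prec w (completion (u @ [q - 1]))
           else \<not> prec (completion (u @ [q - 1])) w" for u w
      proof (rule ccontr)
        assume ne: "take (Suc (Suc k)) w \<noteq> u @ [q - 1]"
        let ?z = "completion (u @ [q - 1])"
        have lw: "length w = n" using X_take(3) that(1) .
        have lu: "length u = Suc k" using that(2) lw k' by auto
        have tw: "take (Suc (Suc k)) w = u @ [w ! Suc k]"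
          using that(2) lw k' by (simp add: take_Suc_conv_app_nth)
        have tz: "take (Suc (Suc k)) ?z = u @ [q - 1]"
          using lu k' by (subst take_completion) auto
        have zk: "take (Suc k) ?z = u" "?z ! Suc k = q - 1"
          using lu k' take_completion[of "u @ [q - 1]" "Suc k"] tz
          by (simp, metis lessI nth_append_length nth_take)
        have "w ! Suc k < q"
          using X_nth_less that(1) k' by blast
        with ne tw have less: "w ! Suc k < q - 1" by auto
        have "prec w ?z" if "even (sum_list u)"
          unfolding prec_def using less zk \<open>take (Suc k) w = u\<close> that lw k'
          by (intro conjI exI[of _ "Suc k"]) auto
        moreover have "prec ?z w" if "odd (sum_list u)"
          unfolding prec_def using less zk \<open>take (Suc k) w = u\<close> that lw k'
          by (intro conjI exI[of _ "Suc k"]) auto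
        ultimately show False
          using that(3) by presburger
      qed
      have sk2: "take (length \<alpha>) s = \<alpha>"
        using *[OF s sk] sz True by (simp add: \<alpha>_def lp)
      have tk2: "take (length \<beta>) t = \<beta>"
        using *[OF t tk] tz odd_b by (simp add: \<beta>_def lp)
      have "odd (sum_list \<alpha>)" "even (sum_list \<beta>)"
        using True odd_b q by (auto simp: \<alpha>_def \<beta>_def)
      then have "s = completion \<alpha>" "t = completion \<beta>"
        using completion_eqI[OF s sk2] completion_eqI[OF t tk2] sz tz by auto
      moreover have "\<alpha> ! i = \<beta> ! i" if "i < length \<alpha>" "i \<noteq> k" for i
        using that lp by (auto simp: \<alpha>_def \<beta>_def nth_append)
      ultimately have "diff_positions s t \<subseteq> {k, Suc (Suc k) + l - 1, Suc (Suc k) + l}"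
        using diff_positions_completion[of \<alpha> \<beta> k] lens by simp
      with kD show ?thesis
        by (intro exI[of _ k] exI[of _ "Suc (Suc k)"]) auto
    qed
  qed
qed

section \<open>The listing and the theorem\<close>

lemma listing_close: "close_gray_code (l + 2) 3 (prec_listing X)"
  unfolding close_gray_code_def
proof (intro allI impI)
  fix i
  let ?xs = "prec_listing X"
  assume i: "Suc i < length ?xs"
  let ?s = "?xs ! i" and ?t = "?xs ! Suc i"
  have sorted: "prec (?xs ! j) (?xs ! j')" if "j < j'" "j' < length ?xs" for j j'
    using sorted_wrt_nth_less[OF prec_listing_avoiding(2)] that by blast
  have "?s \<in> X" "?t \<in> X"
    using i prec_listing_avoiding(1) by (metis Suc_lessD nth_mem, metis nth_mem)
  moreover have "prec ?s ?t" using sorted i by simp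
  moreover have "\<not> prec w ?t" if "w \<in> X" "prec ?s w" for w
  proof
    assume wt: "prec w ?t"
    obtain j where j: "j < length ?xs" "w = ?xs ! j"
      using \<open>w \<in> X\<close> prec_listing_avoiding(1) by (metis in_set_conv_nth)
    \<comment> \<open>The list is sorted, so a word strictly between two neighbours would need an
      index strictly between \<open>i\<close> and \<open>Suc i\<close>.\<close>
    have "\<not> j < i" "j \<noteq> i" "j \<noteq> Suc i" "\<not> Suc i < j"
      using sorted[of j i] sorted[of "Suc i" j] i j that wt prec_trans prec_irrefl
      by (meson Suc_lessD)+
    then show False by simp
  qed
  ultimately obtain k m where km: "m \<le> k + 2" "k \<in> diff_positions ?s ?t" "k < m"
    "diff_positions ?s ?t \<subseteq> {k, m + l - 1, m + l}"
    using consecutive_close by blast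
  let ?D = "diff_positions ?s ?t"
  have fin: "finite ?D" using km(4) finite_subset by blast
  have "card ?D \<le> card {k, m + l - 1, m + l}"
    using km(4) by (intro card_mono) auto
  also have "\<dots> \<le> 3" by (simp add: card_insert_if)
  finally have "card ?D \<le> 3" .
  moreover have "card {Min ?D<..<Max ?D} < l + 2"
  proof -
    have "Min ?D \<in> ?D" "Max ?D \<in> ?D"
      using fin km(2) by (auto intro: Min_in Max_in)
    \<comment> \<open>All differences lie from \<open>k\<close> to \<open>m + l\<close>, hence at
      most up to \<open>k + l + 2\<close>, with \<open>l + 1\<close> positions strictly between
      these bounds.\<close>
    then have "k \<le> Min ?D" "Max ?D \<le> k + l + 2"
      using km l by auto
    then show ?thesis by simp
  qed
  ultimately show "let D = ?D in card D \<le> 3 \<and> card {Min D<..<Max D} < l + 2"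
    by (simp add: Let_def)
qed

end

text \<open>The period with \<open>m\<close> zeros ends in those zeros, so they form a suffix of its
  left-infinite power. Hence a word outside \<open>U q\<close> has a nonzero symbol, which makes the
  stem \<open>x\<close> nonempty.\<close>

lemma replicate_0_in_U: "replicate (Suc m) 0 \<in> U q"
proof -
  have "left_inf_suffix (replicate m 0) (left_inf_power ([1, q - 1] @ replicate m 0))"
    by (simp add: left_inf_suffix_def left_inf_power_def nth_append)
  moreover have "replicate (Suc m) 0 = replicate m 0 @ [0::nat]"
    by (simp add: replicate_append_same)
  ultimately show ?thesis
    unfolding U_def by blast
qed

theorem theorem4:
  fixes q n :: nat and f :: "nat list"
  assumes "q \<ge> 2" and "even q"
    and "f \<noteq> []" and "set f \<subseteq> {..<q}" and "f \<notin> U q"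
    and "last f = 0"
    and "n \<ge> 1"
  shows "close_gray_code (trailing_zeros f + 2) 3 (prec_listing (avoiding (words q n) f))"
proof -
  define l where "l = trailing_zeros f"
  define x where "x = rev (dropWhile (\<lambda>c. c = 0) (rev f))"
  have "takeWhile (\<lambda>c. c = 0) (rev f) = replicate l 0"
    unfolding l_def trailing_zeros_def
    by (intro replicate_length_same[symmetric]) (auto dest: set_takeWhileD)
  then have f: "f = x @ replicate l 0"
    using takeWhile_dropWhile_id[of "\<lambda>c. c = 0" "rev f"] unfolding x_def
    by (metis rev_append rev_replicate rev_rev_ident)
  have l: "l \<ge> 1"
    using assms(3,6) by (cases f rule: rev_cases) (auto simp: l_def trailing_zeros_def)
  have x: "x \<noteq> []"
    using f l assms(5) replicate_0_in_U[of "l - 1" q] by auto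
  have "last x \<noteq> 0"
    using x hd_dropWhile[of "\<lambda>c. c = 0" "rev f"] by (auto simp: x_def last_rev)
  moreover have "x @ replicate l 0 \<notin> U q"
    using assms(5) f by simp
  ultimately interpret zero_ended_factor q l n x
    using assms(1,2) l x by unfold_locales
  show ?thesis
    using listing_close by (simp only: f[symmetric] l_def[symmetric])
qed

end
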